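(* For all $n\ge 1$ and all $\varepsilon\in(0,(2n)^{-1}]$, the set $\mathcal{D}_{n,\varepsilon}$ of $n\times n$ $\varepsilon$-domestic matrices (with matrix multiplication and the standard topology) is a compact and convergent semigroup.
   Context: A matrix is doubly stochastic if it is a non-negative real square matrix in which every row and every column sums to $1$; $\mathcal{D}_n$ is the set of $n\times n$ doubly stochastic matrices. For $\varepsilon\in(0,(2n)^{-1}]$, a matrix $M\in\mathcal{D}_n$ is $\varepsilon$-domestic if there do not exist subsets $X,Y\subseteq\{1,\ldots,n\}$ with $X\neq Y$, $|X|=|Y|$ and $\sum_{i\in X,j\in Y}M[i,j]>(1-\varepsilon)|X|$. $\mathcal{D}_{n,\varepsilon}$ is the set of all $\varepsilon$-domestic matrices in $\mathcal{D}_n$, topologized as a subspace of $\mathbb{R}^{n^2}$. The (right) infinite product $\prod_{i\in\mathbb{N}}S_i$ in a topological semigroup $\mathcal{S}$ is the limit of the sequence $(S_0S_1\cdots S_i)_{i\in\mathbb{N}}$; it converges if the limit exists in $\mathcal{S}$. A topological semigroup (Hausdorff topology, continuous multiplication) is convergent if every infinite product of its elements converges. *)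

theory Defs
  imports "HOL-Analysis.Analysis"
begin

definition doubly_stochastic :: "real ^ 'n ^ 'n \<Rightarrow> bool" where
  "doubly_stochastic M \<longleftrightarrow>
     (\<forall>i j. 0 \<le> M $ i $ j) \<and>
     (\<forall>i. (\<Sum>j\<in>UNIV. M $ i $ j) = 1) \<and>
     (\<forall>j. (\<Sum>i\<in>UNIV. M $ i $ j) = 1)"

definition domestic :: "real \<Rightarrow> real ^ 'n ^ 'n \<Rightarrow> bool" where
  "domestic \<epsilon> M \<longleftrightarrow>
     doubly_stochastic M \<and>
     \<not> (\<exists>X Y :: 'n set. X \<noteq> Y \<and> card X = card Y \<and>
          (\<Sum>i\<in>X. \<Sum>j\<in>Y. M $ i $ j) > (1 - \<epsilon>) * real (card X))"

definition domestic_matrices :: "real \<Rightarrow> (real ^ 'n ^ 'n) set" where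
  "domestic_matrices \<epsilon> = {M. domestic \<epsilon> M}"

definition topological_semigroup :: "'a topology \<Rightarrow> ('a \<Rightarrow> 'a \<Rightarrow> 'a) \<Rightarrow> bool" where
  "topological_semigroup T f \<longleftrightarrow>
     Hausdorff_space T \<and>
     (\<forall>x\<in>topspace T. \<forall>y\<in>topspace T. f x y \<in> topspace T) \<and>
     (\<forall>x\<in>topspace T. \<forall>y\<in>topspace T. \<forall>z\<in>topspace T. f (f x y) z = f x (f y z)) \<and>
     continuous_map (prod_topology T T) T (\<lambda>(x, y). f x y)"

primrec partial_product :: "('a \<Rightarrow> 'a \<Rightarrow> 'a) \<Rightarrow> (nat \<Rightarrow> 'a) \<Rightarrow> nat \<Rightarrow> 'a" where
  "partial_product f S 0 = S 0"
| "partial_product f S (Suc i) = f (partial_product f S i) (S (Suc i))"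

text \<open>The limit in \<open>limitin\<close> is required to lie in the space itself, so convergence here
  means convergence within the semigroup, not in some ambient space.\<close>

definition convergent_semigroup :: "'a topology \<Rightarrow> ('a \<Rightarrow> 'a \<Rightarrow> 'a) \<Rightarrow> bool" where
  "convergent_semigroup T f \<longleftrightarrow>
     topological_semigroup T f \<and>
     (\<forall>S. (\<forall>i. S i \<in> topspace T) \<longrightarrow>
        (\<exists>L. limitin T (partial_product f S) L sequentially))"

end

theory Submission
  imports Defs
begin

text \<open>
  Closure under products: the entry sum of \<open>M ** N\<close> over \<open>X \<times> Z\<close> is \<open>\<Sum>j. a j * b j\<close>, where \<open>a j\<close> is
  the sum of column \<open>j\<close> of \<open>M\<close> over \<open>X\<close> and \<open>b j\<close> that of row \<open>j\<close> of \<open>N\<close> over \<open>Z\<close>. Both have entries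
  in \<open>[0,1]\<close> and total \<open>k = card X\<close>, so if the sum exceeds \<open>k - 1/2\<close>, then
  \<open>\<Sum>j. a j * (1 - b j) + (1 - a j) * b j < 1\<close>. Hence rounding \<open>a\<close> and \<open>b\<close> to \<open>{0,1}\<close> yields one and
  the same \<open>k\<close>-element set, while domesticity of \<open>M\<close> and \<open>N\<close> forces this set to be \<open>X\<close> and \<open>Z\<close>
  respectively.

  Convergence: in a compact semigroup any two cluster points of the partial products are right
  multiples of each other, so it suffices that mutual right multiples are equal. A doubly stochastic
  matrix does not increase the norm of a row vector \<open>x\<close>, and if it preserves the norm, then its
  nonzero entries only link coordinates with equal values in \<open>x\<close> and in the image of \<open>x\<close>; for a
  domestic matrix this forces the image to be \<open>x\<close> itself.
\<close>

definition cluster_points :: "'a topology \<Rightarrow> (nat \<Rightarrow> 'a) \<Rightarrow> 'a set" where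
  "cluster_points X s = (\<Inter>m. X closure_of (s ` {m..}))"

lemma closedin_imp_cluster_points_subset:
  assumes "closedin X C" and "\<And>n. n \<ge> m \<Longrightarrow> s n \<in> C"
  shows "cluster_points X s \<subseteq> C"
proof -
  have "X closure_of (s ` {m..}) \<subseteq> C"
    using assms by (intro closure_of_minimal) auto
  then show ?thesis by (auto simp: cluster_points_def)
qed

lemma compact_space_imp_cluster_point:
  assumes "compact_space X" and "closedin X C" and frequently: "\<exists>\<^sub>F n in sequentially. s n \<in> C"
  shows "cluster_points X s \<inter> C \<noteq> {}"
proof -
  define K where "K m = X closure_of (s ` {m..} \<inter> C)" for m
  have nonempty: "(\<Inter>m. K m) \<noteq> {}"
  proof (rule compact_space_imp_nest[OF \<open>compact_space X\<close>])
    show "closedin X (K m)" for m by (simp add: K_def)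
    show "decseq K" unfolding K_def decseq_def by (intro allI impI closure_of_mono) auto
    show "K m \<noteq> {}" for m
    proof -
      obtain n where "n \<ge> m" "s n \<in> C"
        using frequently unfolding frequently_sequentially by blast
      then have "s n \<in> s ` {m..} \<inter> C" by simp
      moreover have "s ` {m..} \<inter> C \<subseteq> K m"
        unfolding K_def using closedin_subset[OF \<open>closedin X C\<close>] by (intro closure_of_subset) auto
      ultimately show ?thesis by blast
    qed
  qed
  have "(\<Inter>m. K m) \<subseteq> cluster_points X s"
    unfolding K_def cluster_points_def by (intro INF_mono' closure_of_mono) simp
  moreover have "K 0 \<subseteq> C"
    unfolding K_def using \<open>closedin X C\<close> by (intro closure_of_minimal) auto
  ultimately show ?thesis using nonempty by blast
qed

lemma compact_space_imp_limitin_of_unique_cluster_point: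
  assumes X: "compact_space X" and s: "\<And>n. s n \<in> topspace X"
    and unique: "\<And>x y. x \<in> cluster_points X s \<Longrightarrow> y \<in> cluster_points X s \<Longrightarrow> x = y"
  shows "\<exists>x. limitin X s x sequentially"
proof -
  have "cluster_points X s \<inter> topspace X \<noteq> {}"
    using s by (intro compact_space_imp_cluster_point[OF X]) (auto simp: frequently_sequentially)
  then obtain x where x: "x \<in> cluster_points X s" "x \<in> topspace X" by auto
  have "limitin X s x sequentially"
    unfolding limitin_def
  proof (intro conjI allI impI)
    fix U assume U: "openin X U \<and> x \<in> U"
    show "\<forall>\<^sub>F n in sequentially. s n \<in> U"
    proof (rule ccontr)
      assume "\<not> ?thesis"
      then have "\<exists>\<^sub>F n in sequentially. s n \<in> topspace X - U"
        using s by (simp add: not_eventually)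
      then have "cluster_points X s \<inter> (topspace X - U) \<noteq> {}"
        using U by (intro compact_space_imp_cluster_point[OF X]) auto
      then show False using unique[OF x(1)] U by auto
    qed
  qed (fact x(2))
  then show ?thesis ..
qed

lemma partial_product_in_semigroup:
  assumes "topological_semigroup X f" and "range S \<subseteq> topspace X"
  shows "partial_product f S n \<in> topspace X"
  using assms by (induction n) (auto simp: topological_semigroup_def)

lemma partial_product_right_multiple:
  assumes semigroup: "topological_semigroup X f" and S: "range S \<subseteq> topspace X" and "m < n"
  shows "\<exists>q\<in>topspace X. partial_product f S n = f (partial_product f S m) q"
  using \<open>m < n\<close>
proof (induction n)
  case 0
  then show ?case by simp
next
  case (Suc n)
  show ?case
  proof (cases "m = n")
    case True
    then show ?thesis using S by auto
  next
    case False
    then obtain q where q: "q \<in> topspace X" "partial_product f S n = f (partial_product f S m) q"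
      using Suc by auto
    have S_Suc: "S (Suc n) \<in> topspace X" using S by auto
    have "partial_product f S (Suc n) = f (partial_product f S m) (f q (S (Suc n)))"
      using semigroup S_Suc q partial_product_in_semigroup[OF semigroup S, of m]
      by (simp add: topological_semigroup_def)
    moreover have "f q (S (Suc n)) \<in> topspace X"
      using semigroup S_Suc q(1) by (simp add: topological_semigroup_def)
    ultimately show ?thesis by blast
  qed
qed

lemma closedin_right_multiples:
  assumes "compact_space X" and semigroup: "topological_semigroup X f" and "p \<in> topspace X"
  shows "closedin X (f p ` topspace X)"
proof -
  have "continuous_map X (prod_topology X X) (\<lambda>q. (p, q))"
    using \<open>p \<in> topspace X\<close> by (simp add: continuous_map_pairwise o_def)
  moreover have "continuous_map (prod_topology X X) X (\<lambda>(p, q). f p q)"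
    using semigroup by (simp add: topological_semigroup_def)
  ultimately have "continuous_map X X (f p)"
    using continuous_map_compose by (fastforce simp: o_def)
  then have "compactin X (f p ` topspace X)"
    using \<open>compact_space X\<close> by (auto simp: compact_space_def intro: image_compactin)
  then show ?thesis
    using semigroup by (intro compactin_imp_closedin) (auto simp: topological_semigroup_def)
qed

lemma closedin_left_divisors:
  assumes "compact_space X" and semigroup: "topological_semigroup X f" and "y \<in> topspace X"
  shows "closedin X {p \<in> topspace X. \<exists>q\<in>topspace X. y = f p q}"
proof -
  let ?factorizations = "{u \<in> topspace (prod_topology X X). (\<lambda>(p, q). f p q) u \<in> {y}}"
  have "closedin (prod_topology X X) ?factorizations"
    using semigroup \<open>y \<in> topspace X\<close>
    by (intro closedin_continuous_map_preimage[where Y = X])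
      (auto simp: topological_semigroup_def closedin_Hausdorff_singleton)
  then have "closedin X (fst ` ?factorizations)"
    using Abstract_Topological_Spaces.closed_map_fst[OF \<open>compact_space X\<close>]
    unfolding closed_map_def by blast
  moreover have "fst ` ?factorizations = {p \<in> topspace X. \<exists>q\<in>topspace X. y = f p q}"
    by (auto simp: image_def Bex_def)
  ultimately show ?thesis by simp
qed

lemma cluster_points_partial_product_right_multiple:
  assumes compact: "compact_space X" and semigroup: "topological_semigroup X f"
    and S: "range S \<subseteq> topspace X"
    and x: "x \<in> cluster_points X (partial_product f S)"
    and y: "y \<in> cluster_points X (partial_product f S)"
  shows "\<exists>q\<in>topspace X. y = f x q"
proof -
  note P = partial_product_in_semigroup[OF semigroup S]
  have "y \<in> f (partial_product f S m) ` topspace X" for m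
  proof -
    have "cluster_points X (partial_product f S) \<subseteq> f (partial_product f S m) ` topspace X"
    proof (rule closedin_imp_cluster_points_subset)
      show "closedin X (f (partial_product f S m) ` topspace X)"
        by (rule closedin_right_multiples[OF compact semigroup P])
      show "partial_product f S n \<in> f (partial_product f S m) ` topspace X" if "n \<ge> Suc m" for n
        using partial_product_right_multiple[OF semigroup S, of m n] that by auto
    qed
    then show ?thesis using y by blast
  qed
  moreover have "y \<in> topspace X"
    using y by (auto simp: cluster_points_def in_closure_of)
  ultimately have "cluster_points X (partial_product f S)
      \<subseteq> {p \<in> topspace X. \<exists>q\<in>topspace X. y = f p q}"
    using P
    by (intro closedin_imp_cluster_points_subset[where m = 0]
        closedin_left_divisors compact semigroup) auto
  then show ?thesis using x by blast
qed

text \<open>Triviality of Green's relation \<open>\<R>\<close>.\<close>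

definition R_trivial :: "'a set \<Rightarrow> ('a \<Rightarrow> 'a \<Rightarrow> 'a) \<Rightarrow> bool" where
  "R_trivial A f \<longleftrightarrow>
     (\<forall>x\<in>A. \<forall>y\<in>A. (\<exists>p\<in>A. y = f x p) \<longrightarrow> (\<exists>q\<in>A. x = f y q) \<longrightarrow> x = y)"

theorem compact_R_trivial_imp_convergent_semigroup:
  assumes compact: "compact_space X" and semigroup: "topological_semigroup X f"
    and trivial: "R_trivial (topspace X) f"
  shows "convergent_semigroup X f"
  unfolding convergent_semigroup_def
proof (intro conjI allI impI)
  fix S :: "nat \<Rightarrow> 'a" assume "\<forall>i. S i \<in> topspace X"
  then have S: "range S \<subseteq> topspace X" by auto
  show "\<exists>L. limitin X (partial_product f S) L sequentially"
  proof (rule compact_space_imp_limitin_of_unique_cluster_point[OF compact])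
    fix x y
    assume xy: "x \<in> cluster_points X (partial_product f S)"
      "y \<in> cluster_points X (partial_product f S)"
    then have "x \<in> topspace X" "y \<in> topspace X"
      by (auto simp: cluster_points_def in_closure_of)
    moreover note right_multiple =
      cluster_points_partial_product_right_multiple[OF compact semigroup S]
    ultimately show "x = y"
      using trivial right_multiple[OF xy] right_multiple[OF xy(2,1)] by (simp add: R_trivial_def)
  qed (rule partial_product_in_semigroup[OF semigroup S])
qed (fact semigroup)

lemma topological_semigroup_matrix_mult:
  fixes D :: "('a::real_normed_algebra_1 ^ 'n ^ 'n) set"
  assumes closed: "\<And>M N. M \<in> D \<Longrightarrow> N \<in> D \<Longrightarrow> M ** N \<in> D"
  shows "topological_semigroup (top_of_set D) (**)"
proof -
  have "continuous_on (D \<times> D) (\<lambda>(M, N). M ** N)"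
    unfolding matrix_matrix_mult_def case_prod_beta by (intro continuous_intros)
  then have "continuous_map (prod_topology (top_of_set D) (top_of_set D)) (top_of_set D)
      (\<lambda>(M, N). M ** N)"
    using closed by (auto simp: continuous_map_in_subtopology simp flip: subtopology_Times)
  then show ?thesis
    using closed
    by (auto simp: topological_semigroup_def matrix_mul_assoc Hausdorff_space_subtopology)
qed

text \<open>The probability that independent random bits of expectations \<open>x\<close> and \<open>y\<close> differ.\<close>

definition disagreement :: "real \<Rightarrow> real \<Rightarrow> real" where
  "disagreement x y = x * (1 - y) + (1 - x) * y"

lemma disagreement_ge_min:
  assumes "0 \<le> y" "y \<le> 1"
  shows "min x (1 - x) \<le> disagreement x y"
proof -
  have "min x (1 - x) = min x (1 - x) * (1 - y) + min x (1 - x) * y"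
    by (simp add: algebra_simps)
  also have "\<dots> \<le> disagreement x y"
    unfolding disagreement_def using assms by (intro add_mono mult_right_mono) auto
  finally show ?thesis .
qed

lemma disagreement_ge_half:
  assumes "1/2 \<le> x \<and> y \<le> 1/2 \<or> x \<le> 1/2 \<and> 1/2 \<le> y"
  shows "1/2 \<le> disagreement x y"
proof -
  have "0 \<le> (x - 1/2) * (1/2 - y)"
    using assms by (auto intro: mult_nonneg_nonneg mult_nonpos_nonpos)
  then show ?thesis by (simp add: disagreement_def algebra_simps)
qed

lemma sum_disagreement:
  "(\<Sum>j\<in>A. disagreement (a j) (b j)) = sum a A + sum b A - 2 * (\<Sum>j\<in>A. a j * b j)"
  by (simp add: disagreement_def algebra_simps sum.distrib sum_subtractf sum_distrib_left)

definition majority :: "'a set \<Rightarrow> ('a \<Rightarrow> real) \<Rightarrow> 'a set" where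
  "majority A a = {j \<in> A. 1/2 < a j}"

lemma sum_min_complement_eq_majority:
  assumes "finite A"
  shows "(\<Sum>j\<in>A. min (a j) (1 - a j))
    = real (card (majority A a)) + sum a A - 2 * sum a (majority A a)"
proof -
  let ?T = "majority A a"
  have T: "?T \<subseteq> A" by (auto simp: majority_def)
  have "(\<Sum>j\<in>A. min (a j) (1 - a j))
      = (\<Sum>j\<in>A - ?T. min (a j) (1 - a j)) + (\<Sum>j\<in>?T. min (a j) (1 - a j))"
    by (rule sum.subset_diff[OF T \<open>finite A\<close>])
  also have "\<dots> = sum a (A - ?T) + (\<Sum>j\<in>?T. 1 - a j)"
    by (intro arg_cong2[where f = "(+)"] sum.cong) (auto simp: majority_def)
  also have "sum a (A - ?T) = sum a A - sum a ?T"
    using T \<open>finite A\<close> by (simp add: sum_diff)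
  finally show ?thesis by (simp add: sum_subtractf)
qed

lemma majority_of_large_sum_mult:
  assumes "finite A" and a: "a \<in> A \<rightarrow> {0..1}" and b: "b \<in> A \<rightarrow> {0..1}"
    and total: "sum a A = real k" "sum b A = real k"
    and large: "real k - 1/2 < (\<Sum>j\<in>A. a j * b j)"
  shows "card (majority A a) = k" and "(\<Sum>j\<in>A. a j * b j) \<le> sum a (majority A a)"
proof -
  let ?T = "majority A a"
  have "real (card ?T) + real k - 2 * sum a ?T = (\<Sum>j\<in>A. min (a j) (1 - a j))"
    using sum_min_complement_eq_majority[OF \<open>finite A\<close>] total by simp
  also have "\<dots> \<le> (\<Sum>j\<in>A. disagreement (a j) (b j))"
    using b by (intro sum_mono disagreement_ge_min) auto
  also have "\<dots> = 2 * real k - 2 * (\<Sum>j\<in>A. a j * b j)"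
    using total by (simp add: sum_disagreement)
  finally have bound: "real (card ?T) + real k - 2 * sum a ?T
      \<le> 2 * real k - 2 * (\<Sum>j\<in>A. a j * b j)" .
  have "sum a ?T \<le> sum a A"
    using \<open>finite A\<close> a by (intro sum_mono2) (auto simp: majority_def)
  moreover have "sum a ?T \<le> real (card ?T)"
    using sum_bounded_above[of ?T a 1] a by (force simp: majority_def)
  ultimately have "\<bar>real (card ?T) - real k\<bar> < 1"
    using bound large total by linarith
  then show card: "card ?T = k" by linarith
  show "(\<Sum>j\<in>A. a j * b j) \<le> sum a ?T" using bound card by simp
qed

lemma majority_eq_of_large_sum_mult:
  assumes "finite A" and a: "a \<in> A \<rightarrow> {0..1}" and b: "b \<in> A \<rightarrow> {0..1}"
    and total: "sum a A = real k" "sum b A = real k"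
    and large: "real k - 1/2 < (\<Sum>j\<in>A. a j * b j)"
  shows "majority A a = majority A b"
proof (rule ccontr)
  assume neq: "majority A a \<noteq> majority A b"
  have card: "card (majority A a) = k" "card (majority A b) = k"
    using majority_of_large_sum_mult[OF \<open>finite A\<close> a b total large]
      majority_of_large_sum_mult[OF \<open>finite A\<close> b a total(2,1)] large
    by (simp_all add: mult.commute)
  have finite: "finite (majority A a)" "finite (majority A b)"
    using \<open>finite A\<close> by (auto simp: majority_def)
  have "\<not> majority A a \<subseteq> majority A b" "\<not> majority A b \<subseteq> majority A a"
    using card_subset_eq[of "majority A a" "majority A b"]
      card_subset_eq[of "majority A b" "majority A a"] neq card finite by auto
  then obtain i j where
    ij: "i \<in> majority A a - majority A b" "j \<in> majority A b - majority A a" by auto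
  then have "1/2 \<le> disagreement (a i) (b i)" "1/2 \<le> disagreement (a j) (b j)" "i \<noteq> j"
    using disagreement_ge_half[of "a i" "b i"] disagreement_ge_half[of "a j" "b j"]
    by (auto simp: majority_def)
  then have "1 \<le> (\<Sum>l\<in>{i, j}. disagreement (a l) (b l))" by simp
  also have "\<dots> \<le> (\<Sum>l\<in>A. disagreement (a l) (b l))"
  proof (rule sum_mono2[OF \<open>finite A\<close>])
    show "{i, j} \<subseteq> A" using ij by (auto simp: majority_def)
    show "0 \<le> disagreement (a l) (b l)" if "l \<in> A - {i, j}" for l
      using a b that unfolding disagreement_def by (intro add_nonneg_nonneg mult_nonneg_nonneg) auto
  qed
  also have "\<dots> < 1" using total large by (simp add: sum_disagreement)
  finally show False by simp
qed

lemma ex_common_set_of_large_sum_mult: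
  assumes "finite A" and a: "a \<in> A \<rightarrow> {0..1}" and b: "b \<in> A \<rightarrow> {0..1}"
    and total: "sum a A = real k" "sum b A = real k"
    and large: "real k - 1/2 < (\<Sum>j\<in>A. a j * b j)"
  shows "\<exists>T\<subseteq>A. card T = k \<and> (\<Sum>j\<in>A. a j * b j) \<le> sum a T \<and> (\<Sum>j\<in>A. a j * b j) \<le> sum b T"
proof (intro exI conjI)
  show "majority A a \<subseteq> A" by (auto simp: majority_def)
  show "card (majority A a) = k" "(\<Sum>j\<in>A. a j * b j) \<le> sum a (majority A a)"
    by (rule majority_of_large_sum_mult[OF assms])+
  have "(\<Sum>j\<in>A. b j * a j) \<le> sum b (majority A b)"
    using large
    by (intro majority_of_large_sum_mult[OF \<open>finite A\<close> b a total(2,1)]) (simp add: mult.commute)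
  then show "(\<Sum>j\<in>A. a j * b j) \<le> sum b (majority A a)"
    by (simp add: majority_eq_of_large_sum_mult[OF assms] mult.commute)
qed

definition block_sum :: "'a::comm_monoid_add ^ 'n ^ 'm \<Rightarrow> 'm set \<Rightarrow> 'n set \<Rightarrow> 'a" where
  "block_sum M X Y = (\<Sum>i\<in>X. \<Sum>j\<in>Y. M $ i $ j)"

lemma sum_block_sum_columns: "(\<Sum>j\<in>Y. block_sum M X {j}) = block_sum M X Y"
  unfolding block_sum_def by (subst sum.swap) simp

lemma sum_block_sum_rows: "(\<Sum>i\<in>X. block_sum M {i} Y) = block_sum M X Y"
  by (simp add: block_sum_def)

lemma block_sum_mult:
  fixes M :: "'a::semiring_1 ^ 'k::finite ^ 'm" and N :: "'a ^ 'n ^ 'k"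
  shows "block_sum (M ** N) X Z = (\<Sum>j\<in>UNIV. block_sum M X {j} * block_sum N {j} Z)"
proof -
  have "block_sum (M ** N) X Z = (\<Sum>i\<in>X. \<Sum>j\<in>UNIV. \<Sum>l\<in>Z. M $ i $ j * N $ j $ l)"
    unfolding block_sum_def matrix_matrix_mult_def by (simp add: sum.swap[of _ UNIV Z])
  also have "\<dots> = (\<Sum>j\<in>UNIV. \<Sum>i\<in>X. \<Sum>l\<in>Z. M $ i $ j * N $ j $ l)"
    by (rule sum.swap)
  finally show ?thesis by (simp add: block_sum_def sum_product)
qed

lemma doubly_stochastic_iff:
  "doubly_stochastic M \<longleftrightarrow> (\<forall>i j. 0 \<le> M $ i $ j) \<and> M *v 1 = 1 \<and> 1 v* M = 1"
  by (simp add: doubly_stochastic_def vec_eq_iff matrix_vector_mult_def vector_matrix_mult_def)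

lemma doubly_stochastic_mult:
  assumes M: "doubly_stochastic M" and N: "doubly_stochastic N"
  shows "doubly_stochastic (M ** N)"
  unfolding doubly_stochastic_iff
proof (intro conjI allI)
  show "0 \<le> (M ** N) $ i $ j" for i j
    using M N by (simp add: matrix_matrix_mult_def doubly_stochastic_def sum_nonneg)
  show "(M ** N) *v 1 = 1"
    using M N by (simp add: doubly_stochastic_iff flip: matrix_vector_mul_assoc)
  show "1 v* (M ** N) = 1"
    using M N by (simp add: doubly_stochastic_iff flip: vector_matrix_mul_assoc)
qed

lemma block_sum_UNIV_right:
  "doubly_stochastic M \<Longrightarrow> block_sum M X UNIV = real (card X)"
  by (simp add: block_sum_def doubly_stochastic_def)

lemma block_sum_UNIV_left:
  "doubly_stochastic M \<Longrightarrow> block_sum M UNIV Y = real (card Y)"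
  unfolding block_sum_def by (subst sum.swap) (simp add: doubly_stochastic_def)

lemma block_sum_mono:
  assumes M: "doubly_stochastic M" and "X \<subseteq> X'" "Y \<subseteq> Y'"
  shows "block_sum M X Y \<le> block_sum M X' Y'"
proof -
  have "block_sum M X Y \<le> (\<Sum>i\<in>X. \<Sum>j\<in>Y'. M $ i $ j)"
    unfolding block_sum_def using M \<open>Y \<subseteq> Y'\<close>
    by (intro sum_mono sum_mono2) (auto simp: doubly_stochastic_def)
  also have "\<dots> \<le> block_sum M X' Y'"
    unfolding block_sum_def using M \<open>X \<subseteq> X'\<close>
    by (intro sum_mono2) (auto simp: doubly_stochastic_def intro: sum_nonneg)
  finally show ?thesis .
qed

lemma block_sum_nonneg: "doubly_stochastic M \<Longrightarrow> 0 \<le> block_sum M X Y"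
  by (simp add: block_sum_def doubly_stochastic_def sum_nonneg)

lemma block_sum_singleton_le_1:
  assumes M: "doubly_stochastic M"
  shows "block_sum M X {j} \<le> 1" and "block_sum M {i} Y \<le> 1"
  using block_sum_mono[OF M, of X UNIV "{j}" "{j}"] block_sum_mono[OF M, of "{i}" "{i}" Y UNIV]
  by (simp_all add: block_sum_UNIV_left[OF M] block_sum_UNIV_right[OF M])

lemma ex_intermediate_set_of_large_block_sum_mult:
  assumes M: "doubly_stochastic M" and N: "doubly_stochastic N" and card: "card X = card Z"
    and large: "real (card X) - 1/2 < block_sum (M ** N) X Z"
  shows "\<exists>Y. card Y = card X \<and> block_sum (M ** N) X Z \<le> block_sum M X Y
    \<and> block_sum (M ** N) X Z \<le> block_sum N Y Z"
proof -
  define a where "a j = block_sum M X {j}" for j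
  define b where "b j = block_sum N {j} Z" for j
  have "a \<in> UNIV \<rightarrow> {0..1}" "b \<in> UNIV \<rightarrow> {0..1}"
    using M N by (auto simp: a_def b_def block_sum_nonneg block_sum_singleton_le_1)
  moreover have "sum a UNIV = real (card X)" "sum b UNIV = real (card X)"
    using M N card
    by (simp_all add: a_def b_def sum_block_sum_columns sum_block_sum_rows
        block_sum_UNIV_right block_sum_UNIV_left)
  moreover have product: "block_sum (M ** N) X Z = (\<Sum>j\<in>UNIV. a j * b j)"
    by (simp add: block_sum_mult a_def b_def)
  ultimately obtain Y where "card Y = card X"
      "(\<Sum>j\<in>UNIV. a j * b j) \<le> sum a Y" "(\<Sum>j\<in>UNIV. a j * b j) \<le> sum b Y"
    using ex_common_set_of_large_sum_mult[of UNIV a b "card X"] large by auto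
  moreover have "sum a Y = block_sum M X Y" "sum b Y = block_sum N Y Z"
    by (simp_all add: a_def b_def sum_block_sum_columns sum_block_sum_rows)
  ultimately show ?thesis using product by auto
qed

lemma domestic_iff:
  "domestic \<epsilon> M \<longleftrightarrow> doubly_stochastic M \<and>
     (\<forall>X Y. card X = card Y \<longrightarrow> (1 - \<epsilon>) * real (card X) < block_sum M X Y \<longrightarrow> X = Y)"
  by (auto simp: domestic_def block_sum_def)

lemma domestic_mult:
  fixes M N :: "real ^ 'n ^ 'n"
  assumes \<epsilon>: "\<epsilon> \<le> 1 / (2 * real CARD('n))" and M: "domestic \<epsilon> M" and N: "domestic \<epsilon> N"
  shows "domestic \<epsilon> (M ** N)"
  unfolding domestic_iff
proof (intro conjI allI impI)
  have stochastic: "doubly_stochastic M" "doubly_stochastic N"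
    using M N by (auto simp: domestic_iff)
  then show "doubly_stochastic (M ** N)" by (rule doubly_stochastic_mult)
  fix X Z :: "'n set"
  assume card: "card X = card Z" and dense: "(1 - \<epsilon>) * real (card X) < block_sum (M ** N) X Z"
  have "\<epsilon> * real (card X) \<le> 1 / (2 * real CARD('n)) * real (card X)"
    using \<epsilon> by (intro mult_right_mono) auto
  also have "\<dots> \<le> 1 / (2 * real CARD('n)) * real CARD('n)"
    by (intro mult_left_mono) (auto simp: card_mono)
  also have "\<dots> = 1/2" by simp
  finally have "real (card X) - 1/2 < block_sum (M ** N) X Z"
    using dense by (simp add: algebra_simps)
  then obtain Y where Y: "card Y = card X"
      "block_sum (M ** N) X Z \<le> block_sum M X Y" "block_sum (M ** N) X Z \<le> block_sum N Y Z"
    using ex_intermediate_set_of_large_block_sum_mult[OF stochastic card] by blast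
  have "X = Y" using M Y(1,2) dense by (simp add: domestic_iff)
  moreover have "Y = Z" using N Y(1,3) card dense by (simp add: domestic_iff)
  ultimately show "X = Z" by simp
qed

lemma domestic_full_block_imp_eq:
  assumes "0 < \<epsilon>" and M: "domestic \<epsilon> M"
    and card: "card X = card Y" and full: "block_sum M X Y = real (card X)"
  shows "X = Y"
proof (cases "X = {}")
  case True
  then show ?thesis using card by simp
next
  case False
  then have "(1 - \<epsilon>) * real (card X) < block_sum M X Y"
    using \<open>0 < \<epsilon>\<close> full by (simp add: card_gt_0_iff)
  then show ?thesis using M card by (simp add: domestic_iff)
qed

lemma doubly_stochastic_sum_squared_differences:
  fixes Q :: "real ^ 'n ^ 'n"
  assumes Q: "doubly_stochastic Q" and y: "y = x v* Q"
  shows "(\<Sum>i\<in>UNIV. \<Sum>j\<in>UNIV. Q $ i $ j * (x $ i - y $ j)\<^sup>2) = (norm x)\<^sup>2 - (norm y)\<^sup>2"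
proof -
  have rows: "(\<Sum>i\<in>UNIV. \<Sum>j\<in>UNIV. Q $ i $ j * (x $ i)\<^sup>2) = x \<bullet> x"
    using Q by (simp add: doubly_stochastic_def inner_vec_def power2_eq_square flip: sum_distrib_right)
  have columns: "(\<Sum>i\<in>UNIV. \<Sum>j\<in>UNIV. Q $ i $ j * (y $ j)\<^sup>2) = y \<bullet> y"
    using Q by (subst sum.swap)
      (simp add: doubly_stochastic_def inner_vec_def power2_eq_square flip: sum_distrib_right)
  have mixed: "(\<Sum>i\<in>UNIV. \<Sum>j\<in>UNIV. Q $ i $ j * (x $ i * y $ j)) = y \<bullet> y"
  proof -
    have "(\<Sum>i\<in>UNIV. \<Sum>j\<in>UNIV. Q $ i $ j * (x $ i * y $ j))
        = (\<Sum>j\<in>UNIV. (\<Sum>i\<in>UNIV. Q $ i $ j * x $ i) * y $ j)"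
      by (subst sum.swap) (simp add: sum_distrib_right mult.assoc)
    also have "\<dots> = y \<bullet> y"
      by (simp add: y inner_vec_def vector_matrix_mult_def mult.commute)
    finally show ?thesis .
  qed
  have "(\<Sum>i\<in>UNIV. \<Sum>j\<in>UNIV. Q $ i $ j * (x $ i - y $ j)\<^sup>2)
      = (\<Sum>i\<in>UNIV. \<Sum>j\<in>UNIV. Q $ i $ j * (x $ i)\<^sup>2)
        - 2 * (\<Sum>i\<in>UNIV. \<Sum>j\<in>UNIV. Q $ i $ j * (x $ i * y $ j))
        + (\<Sum>i\<in>UNIV. \<Sum>j\<in>UNIV. Q $ i $ j * (y $ j)\<^sup>2)"
    by (simp add: power2_diff algebra_simps sum.distrib sum_subtractf sum_distrib_left)
  then show ?thesis by (simp add: rows mixed columns power2_norm_eq_inner)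
qed

lemma norm_vector_doubly_stochastic_mult_le:
  fixes Q :: "real ^ 'n ^ 'n"
  assumes "doubly_stochastic Q"
  shows "norm (x v* Q) \<le> norm x"
proof -
  have "0 \<le> (\<Sum>i\<in>UNIV. \<Sum>j\<in>UNIV. Q $ i $ j * (x $ i - (x v* Q) $ j)\<^sup>2)"
    using assms by (intro sum_nonneg mult_nonneg_nonneg) (auto simp: doubly_stochastic_def)
  then have "(norm (x v* Q))\<^sup>2 \<le> (norm x)\<^sup>2"
    using doubly_stochastic_sum_squared_differences[OF assms refl] by simp
  then show ?thesis by (simp add: power2_le_iff_abs_le)
qed

lemma doubly_stochastic_entry_eq_0_of_norm_eq:
  fixes Q :: "real ^ 'n ^ 'n"
  assumes Q: "doubly_stochastic Q" and norm: "norm (x v* Q) = norm x"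
    and distinct: "x $ i \<noteq> (x v* Q) $ j"
  shows "Q $ i $ j = 0"
proof -
  have "0 \<le> Q $ i $ j * (x $ i - (x v* Q) $ j)\<^sup>2" for i j
    using Q by (simp add: doubly_stochastic_def)
  moreover have "(\<Sum>i\<in>UNIV. \<Sum>j\<in>UNIV. Q $ i $ j * (x $ i - (x v* Q) $ j)\<^sup>2) = 0"
    using doubly_stochastic_sum_squared_differences[OF Q refl] norm by simp
  ultimately show ?thesis
    using distinct by (auto simp: sum_nonneg_eq_0_iff sum_nonneg)
qed

lemma domestic_fixes_vector_of_norm_eq:
  fixes Q :: "real ^ 'n ^ 'n"
  assumes "0 < \<epsilon>" and Q: "domestic \<epsilon> Q" and norm: "norm (x v* Q) = norm x"
  shows "x v* Q = x"
proof -
  have stochastic: "doubly_stochastic Q" using Q by (simp add: domestic_iff)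
  note zero = doubly_stochastic_entry_eq_0_of_norm_eq[OF stochastic norm]
  have level_sets: "{i. x $ i = c} = {j. (x v* Q) $ j = c}" (is "?X = ?Y") for c
  proof -
    have "block_sum Q ?X ?Y = block_sum Q ?X UNIV"
      unfolding block_sum_def by (intro sum.cong sum.mono_neutral_left) (auto intro: zero)
    then have full: "block_sum Q ?X ?Y = real (card ?X)"
      by (simp add: block_sum_UNIV_right[OF stochastic])
    have "block_sum Q ?X ?Y = block_sum Q UNIV ?Y"
      unfolding block_sum_def by (intro sum.mono_neutral_left) (auto intro!: sum.neutral zero)
    then have "card ?X = card ?Y"
      using full by (simp add: block_sum_UNIV_left[OF stochastic])
    then show ?thesis
      using domestic_full_block_imp_eq[OF \<open>0 < \<epsilon>\<close> Q] full by simp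
  qed
  have "x $ j = (x v* Q) $ j" for j using level_sets[of "(x v* Q) $ j"] by blast
  then show ?thesis by (simp add: vec_eq_iff)
qed

lemma R_trivial_domestic_matrices:
  assumes "0 < \<epsilon>"
  shows "R_trivial (domestic_matrices \<epsilon>) (**)"
  unfolding R_trivial_def
proof (intro ballI impI)
  fix M N :: "real ^ 'n ^ 'n"
  assume "\<exists>P\<in>domestic_matrices \<epsilon>. N = M ** P" "\<exists>Q\<in>domestic_matrices \<epsilon>. M = N ** Q"
  then obtain P Q where P: "domestic \<epsilon> P" "N = M ** P" and Q: "domestic \<epsilon> Q" "M = N ** Q"
    by (auto simp: domestic_matrices_def)
  have row_mult: "(A ** B) $ i = A $ i v* B" for A B :: "real ^ 'n ^ 'n" and i
    by (simp add: vec_eq_iff matrix_matrix_mult_def vector_matrix_mult_def mult.commute)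
  have "N $ i = M $ i" for i
  proof -
    have N: "N $ i = M $ i v* P" and M: "M $ i = N $ i v* Q"
      using P(2) Q(2) row_mult by metis+
    have "norm (N $ i) = norm (M $ i)"
      using norm_vector_doubly_stochastic_mult_le[of P "M $ i"]
        norm_vector_doubly_stochastic_mult_le[of Q "N $ i"] P(1) Q(1)
      by (simp add: domestic_iff flip: M N)
    then show ?thesis
      using domestic_fixes_vector_of_norm_eq[OF \<open>0 < \<epsilon>\<close> P(1)] N by simp
  qed
  then show "M = N" by (simp add: vec_eq_iff)
qed

lemma closed_domestic_matrices: "closed (domestic_matrices \<epsilon> :: (real ^ 'n ^ 'n) set)"
  unfolding domestic_matrices_def domestic_iff doubly_stochastic_def block_sum_def
  by (intro closed_Collect_conj closed_Collect_all closed_Collect_imp open_Collect_const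
      closed_Collect_const open_Collect_less closed_Collect_le closed_Collect_eq continuous_intros)

lemma norm_doubly_stochastic_matrix_le:
  fixes M :: "real ^ 'n ^ 'n"
  assumes "doubly_stochastic M"
  shows "norm M \<le> real CARD('n)"
proof -
  have "norm M \<le> (\<Sum>i\<in>UNIV. norm (M $ i))"
    by (simp add: norm_vec_def L2_set_le_sum)
  also have "\<dots> \<le> (\<Sum>i\<in>UNIV. \<Sum>j\<in>UNIV. \<bar>M $ i $ j\<bar>)"
    by (intro sum_mono norm_le_l1_cart)
  also have "\<dots> = real CARD('n)"
    using assms by (simp add: doubly_stochastic_def)
  finally show ?thesis .
qed

lemma compact_domestic_matrices: "compact (domestic_matrices \<epsilon> :: (real ^ 'n ^ 'n) set)"
proof -
  have "bounded (domestic_matrices \<epsilon> :: (real ^ 'n ^ 'n) set)"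
    using norm_doubly_stochastic_matrix_le
    by (auto simp: bounded_iff domestic_matrices_def domestic_iff)
  then show ?thesis
    using closed_domestic_matrices by (simp add: compact_eq_bounded_closed)
qed

theorem theorem5p5:
  fixes \<epsilon> :: real
  assumes "0 < \<epsilon>" and "\<epsilon> \<le> 1 / (2 * real CARD('n::finite))"
  shows "compact_space (top_of_set (domestic_matrices \<epsilon> :: (real ^ 'n ^ 'n) set)) \<and>
         convergent_semigroup (top_of_set (domestic_matrices \<epsilon> :: (real ^ 'n ^ 'n) set)) (**)"
proof
  let ?D = "domestic_matrices \<epsilon> :: (real ^ 'n ^ 'n) set"
  show compact: "compact_space (top_of_set ?D)"
    by (simp add: compact_space_subtopology compact_domestic_matrices)
  have "topological_semigroup (top_of_set ?D) (**)"
    using domestic_mult[OF assms(2)]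
    by (intro topological_semigroup_matrix_mult) (simp add: domestic_matrices_def)
  then show "convergent_semigroup (top_of_set ?D) (**)"
    using R_trivial_domestic_matrices[OF assms(1)]
    by (intro compact_R_trivial_imp_convergent_semigroup compact) simp_all
qed

end
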